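(* The Strongly Certain Functional Dependency problem (SCFD) can be solved in polynomial time: given a schema context on a relation scheme $U$, a relation $r$ over it, and a functional dependency $X\to A$, one can decide in time polynomial in the size of the input whether $r\models_g X\to A$ holds for every strong reality $g$.
   Context: A relation scheme is a finite set $U=\{A_1,\dots,A_n\}$ of attributes with domains $\mathrm{dom}(A)$. A schema context assigns to each $A$ a finite lattice $L_A$ (bottom $0_A$, top $1_A$), given explicitly in the input, and a surjective comparability function $f_A:\mathrm{dom}(A)^2\to L_A$ with $f_A(u,u)=1_A$, $f_A(u,v)=f_A(v,u)$, whose values are assumed computable in constant time and of constant size. $L_U=\prod_A L_A$ (componentwise order). A relation $r$ is a finite set of tuples; $f_U(t_1,t_2)=\langle f_{A_i}(t_1[A_i],t_2[A_i])\rangle_i$, $f_U(r)=\{f_U(t_1,t_2):t_1,t_2\in r\}$. A functional dependency is $X\to A$ with $X\subseteq U$, $A\in U\setminus X$. An attribute interpretation is an increasing $h_A:L_A\to\{0,1\}$ with $h_A(0_A)=0,h_A(1_A)=1$; a schema interpretation is $g(x)=\langle h_{A_1}(x[A_1]),\dots,h_{A_n}(x[A_n])\rangle$, identified with a subset of $U$. A strong reality is a schema interpretation that is a lattice homomorphism into $\{0,1\}^n$ (componentwise order). $r\models_g X\to A$ means: for all $x\in f_U(r)$, $X\subseteq g(x)$ implies $A\in g(x)$. *)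

theory Defs
  imports "HOL-Algebra.Lattice" "HOL-Library.FuncSet" "HOL-Computational_Algebra.Polynomial"
begin

section \<open>Schema contexts, realities and functional dependencies\<close>

definition product_order :: "'a set \<Rightarrow> ('a \<Rightarrow> 'l gorder) \<Rightarrow> ('a \<Rightarrow> 'l) gorder" where
  "product_order U L =
     \<lparr>carrier = (\<Pi>\<^sub>E A\<in>U. carrier (L A)), eq = (=),
      le = (\<lambda>x y. \<forall>A\<in>U. x A \<sqsubseteq>\<^bsub>L A\<^esub> y A)\<rparr>"

text \<open>The two-element lattice: \<^const>\<open>False\<close> is 0 and \<^const>\<open>True\<close> is 1.\<close>

definition two :: "bool gorder" where
  "two = \<lparr>carrier = UNIV, eq = (=), le = (\<le>)\<rparr>"

lemma two_lattice: "lattice two"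
proof unfold_locales
  fix x y :: bool
  have "least two (x \<or> y) (Upper two {x, y})" "greatest two (x \<and> y) (Lower two {x, y})"
    by (auto simp: two_def least_def greatest_def Upper_def Lower_def)
  then show "\<exists>s. least two s (Upper two {x, y})" "\<exists>s. greatest two s (Lower two {x, y})"
    by blast+
qed (auto simp: two_def)

lemma product_order_lattice:
  assumes "\<And>A. A \<in> U \<Longrightarrow> lattice (L A)"
  shows "lattice (product_order U L)"
proof -
  have le: "x \<sqsubseteq>\<^bsub>product_order U L\<^esub> y \<longleftrightarrow> (\<forall>A\<in>U. x A \<sqsubseteq>\<^bsub>L A\<^esub> y A)" for x y
    by (simp add: product_order_def)
  have car: "x \<in> carrier (product_order U L) \<longleftrightarrow> x \<in> (\<Pi>\<^sub>E A\<in>U. carrier (L A))" for x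
    by (simp add: product_order_def)
  have po: "partial_order (L A)" if "A \<in> U" for A
    using assms[OF that] by (simp add: lattice_def upper_semilattice_def)
  interpret partial_order "product_order U L"
  proof unfold_locales
    fix x y assume "x \<sqsubseteq>\<^bsub>product_order U L\<^esub> y" "y \<sqsubseteq>\<^bsub>product_order U L\<^esub> x"
      "x \<in> carrier (product_order U L)" "y \<in> carrier (product_order U L)"
    then have "x = y"
      unfolding le car
      by (intro PiE_ext[of x U _ y]) (auto intro: partial_order.le_antisym[OF po] simp: PiE_mem)
    then show "x .=\<^bsub>product_order U L\<^esub> y" by (simp add: product_order_def)
  next
    fix x y z assume xyz: "x \<sqsubseteq>\<^bsub>product_order U L\<^esub> y" "y \<sqsubseteq>\<^bsub>product_order U L\<^esub> z"
      "x \<in> carrier (product_order U L)" "y \<in> carrier (product_order U L)"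
      "z \<in> carrier (product_order U L)"
    have "x A \<sqsubseteq>\<^bsub>L A\<^esub> z A" if A: "A \<in> U" for A
      using xyz A unfolding le car
      by (intro weak_partial_order.le_trans[OF partial_order.axioms(1)[OF po[OF A]], of "x A" "y A" "z A"])
        auto
    then show "x \<sqsubseteq>\<^bsub>product_order U L\<^esub> z"
      unfolding le by blast
  next
    fix x assume x: "x \<in> carrier (product_order U L)"
    have "x A \<sqsubseteq>\<^bsub>L A\<^esub> x A" if A: "A \<in> U" for A
      using x A unfolding car
      by (intro weak_partial_order.le_refl[OF partial_order.axioms(1)[OF po[OF A]]]) auto
    then show "x \<sqsubseteq>\<^bsub>product_order U L\<^esub> x"
      unfolding le by blast
  qed (auto simp: product_order_def)
  show ?thesis
  proof unfold_locales
    fix x y assume xy: "x \<in> carrier (product_order U L)" "y \<in> carrier (product_order U L)"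
    then have m: "x A \<in> carrier (L A)" "y A \<in> carrier (L A)" if "A \<in> U" for A
      using that by (auto simp: car)
    have "\<exists>s. least (L A) s (Upper (L A) {x A, y A})" if "A \<in> U" for A
      using upper_semilattice.sup_of_two_exists[OF _ m[OF that]] assms[OF that]
      by (simp add: lattice_def)
    then obtain s where s: "\<And>A. A \<in> U \<Longrightarrow> least (L A) (s A) (Upper (L A) {x A, y A})"
      by metis
    have "least (product_order U L) (restrict s U) (Upper (product_order U L) {x, y})"
      using s xy m by (auto simp: least_def Upper_def le car PiE_iff extensional_def)
    then show "\<exists>s. least (product_order U L) s (Upper (product_order U L) {x, y})" by blast
    have "\<exists>s. greatest (L A) s (Lower (L A) {x A, y A})" if "A \<in> U" for A
      using lower_semilattice.inf_of_two_exists[OF _ m[OF that]] assms[OF that]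
      by (simp add: lattice_def)
    then obtain s where s: "\<And>A. A \<in> U \<Longrightarrow> greatest (L A) (s A) (Lower (L A) {x A, y A})"
      by metis
    have "greatest (product_order U L) (restrict s U) (Lower (product_order U L) {x, y})"
      using s xy m by (auto simp: greatest_def Lower_def le car PiE_iff extensional_def)
    then show "\<exists>s. greatest (product_order U L) s (Lower (product_order U L) {x, y})" by blast
  qed
qed

text \<open>
  The library locale \<^locale>\<open>lattice\<close> is a partial order whose equality is \<open>(=)\<close>.
  Boundedness only excludes the empty carrier. A one-element lattice (bottom = top) is
  permitted; such an attribute has no interpretation.
\<close>

locale schema_context =
  fixes U :: "'a set"
    and D :: "'a \<Rightarrow> 'd set"
    and L :: "'a \<Rightarrow> 'l gorder"
    and f :: "'a \<Rightarrow> 'd \<Rightarrow> 'd \<Rightarrow> 'l"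
  assumes finite_scheme: "finite U"
    and lattice: "A \<in> U \<Longrightarrow> bounded_lattice (L A)"
    and finite_lattice: "A \<in> U \<Longrightarrow> finite (carrier (L A))"
    and comparability_onto:
      "A \<in> U \<Longrightarrow> (\<lambda>(u, v). f A u v) ` (D A \<times> D A) = carrier (L A)"
    and comparability_refl: "A \<in> U \<Longrightarrow> u \<in> D A \<Longrightarrow> f A u u = \<top>\<^bsub>L A\<^esub>"
    and comparability_sym:
      "A \<in> U \<Longrightarrow> u \<in> D A \<Longrightarrow> v \<in> D A \<Longrightarrow> f A u v = f A v u"

definition is_relation :: "'a set \<Rightarrow> ('a \<Rightarrow> 'd set) \<Rightarrow> ('a \<Rightarrow> 'd) set \<Rightarrow> bool" where
  "is_relation U D r \<longleftrightarrow> finite r \<and> r \<subseteq> (\<Pi>\<^sub>E A\<in>U. D A)"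

definition is_fd :: "'a set \<Rightarrow> 'a set \<Rightarrow> 'a \<Rightarrow> bool" where
  "is_fd U X A \<longleftrightarrow> X \<subseteq> U \<and> A \<in> U - X"

definition compare_tuples ::
  "'a set \<Rightarrow> ('a \<Rightarrow> 'd \<Rightarrow> 'd \<Rightarrow> 'l) \<Rightarrow> ('a \<Rightarrow> 'd) \<Rightarrow> ('a \<Rightarrow> 'd) \<Rightarrow> ('a \<Rightarrow> 'l)" where
  "compare_tuples U f t1 t2 = (\<lambda>A\<in>U. f A (t1 A) (t2 A))"

definition comparisons ::
  "'a set \<Rightarrow> ('a \<Rightarrow> 'd \<Rightarrow> 'd \<Rightarrow> 'l) \<Rightarrow> ('a \<Rightarrow> 'd) set \<Rightarrow> ('a \<Rightarrow> 'l) set" where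
  "comparisons U f r = {compare_tuples U f t1 t2 | t1 t2. t1 \<in> r \<and> t2 \<in> r}"

definition attribute_interpretation :: "'l gorder \<Rightarrow> ('l \<Rightarrow> bool) \<Rightarrow> bool" where
  "attribute_interpretation L h \<longleftrightarrow> isotone L two h \<and> h \<bottom>\<^bsub>L\<^esub> = False \<and> h \<top>\<^bsub>L\<^esub> = True"

definition schema_interpretation ::
  "'a set \<Rightarrow> ('a \<Rightarrow> 'l gorder) \<Rightarrow> (('a \<Rightarrow> 'l) \<Rightarrow> ('a \<Rightarrow> bool)) \<Rightarrow> bool" where
  "schema_interpretation U L g \<longleftrightarrow>
     (\<exists>h. (\<forall>A\<in>U. attribute_interpretation (L A) (h A)) \<and>
          g = (\<lambda>x\<in>carrier (product_order U L). \<lambda>A\<in>U. h A (x A)))"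

definition strong_reality ::
  "'a set \<Rightarrow> ('a \<Rightarrow> 'l gorder) \<Rightarrow> (('a \<Rightarrow> 'l) \<Rightarrow> ('a \<Rightarrow> bool)) \<Rightarrow> bool" where
  "strong_reality U L g \<longleftrightarrow>
     schema_interpretation U L g \<and>
     join_pres (product_order U L) (product_order U (\<lambda>_. two)) g \<and>
     meet_pres (product_order U L) (product_order U (\<lambda>_. two)) g"

text \<open>The subset of the scheme identified with a 0/1-vector.\<close>

definition as_subset :: "'a set \<Rightarrow> ('a \<Rightarrow> bool) \<Rightarrow> 'a set" where
  "as_subset U b = {A \<in> U. b A}"

definition models_fd ::
  "'a set \<Rightarrow> ('a \<Rightarrow> 'd \<Rightarrow> 'd \<Rightarrow> 'l) \<Rightarrow> ('a \<Rightarrow> 'd) set \<Rightarrow>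
   (('a \<Rightarrow> 'l) \<Rightarrow> ('a \<Rightarrow> bool)) \<Rightarrow> 'a set \<Rightarrow> 'a \<Rightarrow> bool" where
  "models_fd U f r g X A \<longleftrightarrow>
     (\<forall>x\<in>comparisons U f r. X \<subseteq> as_subset U (g x) \<longrightarrow> A \<in> as_subset U (g x))"

definition strongly_certain ::
  "'a set \<Rightarrow> ('a \<Rightarrow> 'l gorder) \<Rightarrow> ('a \<Rightarrow> 'd \<Rightarrow> 'd \<Rightarrow> 'l) \<Rightarrow> ('a \<Rightarrow> 'd) set \<Rightarrow>
   'a set \<Rightarrow> 'a \<Rightarrow> bool" where
  "strongly_certain U L f r X A \<longleftrightarrow> (\<forall>g. strong_reality U L g \<longrightarrow> models_fd U f r g X A)"


section \<open>The model of computation\<close>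

text \<open>
  The machine model is Jones' WHILE language over binary trees (\<^emph>\<open>Computability and
  Complexity from a Programming Perspective\<close>), whose polynomial-time decision problems are
  those of Turing machines, extended with an oracle query of unit cost.

  Leaves are \<open>Null\<close> or symbols \<open>Atom n\<close>. Symbols are uninterpreted: a program cannot
  compute with the number \<open>n\<close> and cannot mention any symbol; it can only copy symbols it
  has read and compare them for equality. Hence a symbol is a value of constant size, and a
  run on an input of size \<open>s\<close> can be simulated on \<open>O(log s)\<close>-bit names, apart from
  the symbols returned by the oracle.
  Every operation is of bounded cost on trees with shared nodes: \<open>Pair\<close> allocates one node,
  and the equality test does not descend into trees (it is false if an argument is a pair).
\<close>

datatype data = Null | Atom nat | Pair data data

fun data_size :: "data \<Rightarrow> nat" where
  "data_size Null = 1"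
| "data_size (Atom n) = 1"
| "data_size (Pair a b) = Suc (data_size a + data_size b)"

fun head :: "data \<Rightarrow> data" where
  "head (Pair a b) = a"
| "head Null = Null"
| "head (Atom n) = Null"

fun tail :: "data \<Rightarrow> data" where
  "tail (Pair a b) = b"
| "tail Null = Null"
| "tail (Atom n) = Null"

fun leaf_eq :: "data \<Rightarrow> data \<Rightarrow> bool" where
  "leaf_eq Null Null = True"
| "leaf_eq (Atom m) (Atom n) = (m = n)"
| "leaf_eq _ _ = False"

text \<open>Truth values: \<open>Null\<close> is false, everything else is true.\<close>

definition of_truth :: "bool \<Rightarrow> data" where
  "of_truth b = (if b then Pair Null Null else Null)"

type_synonym store = "nat \<Rightarrow> data"

datatype expr = Var nat | NULL | PAIR expr expr | HEAD expr | TAIL expr | EQ expr expr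

fun eval :: "expr \<Rightarrow> store \<Rightarrow> data" where
  "eval (Var x) s = s x"
| "eval NULL s = Null"
| "eval (PAIR e e') s = Pair (eval e s) (eval e' s)"
| "eval (HEAD e) s = head (eval e s)"
| "eval (TAIL e) s = tail (eval e s)"
| "eval (EQ e e') s = of_truth (leaf_eq (eval e s) (eval e' s))"

fun eval_cost :: "expr \<Rightarrow> nat" where
  "eval_cost (Var x) = 1"
| "eval_cost NULL = 1"
| "eval_cost (PAIR e e') = Suc (eval_cost e + eval_cost e')"
| "eval_cost (HEAD e) = Suc (eval_cost e)"
| "eval_cost (TAIL e) = Suc (eval_cost e)"
| "eval_cost (EQ e e') = Suc (eval_cost e + eval_cost e')"

datatype com =
    SKIP
  | Assign nat expr
  | Query nat expr
  | Seq com com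
  | Cond expr com com
  | While expr com

text \<open>
  \<open>exec orc c s t s'\<close>: with oracle \<open>orc\<close>, program \<open>c\<close> started in store \<open>s\<close> halts in store
  \<open>s'\<close> after \<open>t\<close> steps.
\<close>

inductive exec :: "(data \<Rightarrow> data) \<Rightarrow> com \<Rightarrow> store \<Rightarrow> nat \<Rightarrow> store \<Rightarrow> bool" for orc where
  exec_SKIP: "exec orc SKIP s 1 s"
| exec_Assign: "exec orc (Assign x e) s (Suc (eval_cost e)) (s(x := eval e s))"
| exec_Query: "exec orc (Query x e) s (Suc (eval_cost e)) (s(x := orc (eval e s)))"
| exec_Seq: "exec orc c1 s t1 s' \<Longrightarrow> exec orc c2 s' t2 s'' \<Longrightarrow>
    exec orc (Seq c1 c2) s (t1 + t2) s''"
| exec_Cond_true: "eval e s \<noteq> Null \<Longrightarrow> exec orc c1 s t s' \<Longrightarrow>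
    exec orc (Cond e c1 c2) s (Suc (eval_cost e + t)) s'"
| exec_Cond_false: "eval e s = Null \<Longrightarrow> exec orc c2 s t s' \<Longrightarrow>
    exec orc (Cond e c1 c2) s (Suc (eval_cost e + t)) s'"
| exec_While_false: "eval e s = Null \<Longrightarrow> exec orc (While e c) s (Suc (eval_cost e)) s"
| exec_While_true: "eval e s \<noteq> Null \<Longrightarrow> exec orc c s t1 s' \<Longrightarrow>
    exec orc (While e c) s' t2 s'' \<Longrightarrow>
    exec orc (While e c) s (Suc (eval_cost e + t1 + t2)) s''"

inductive_cases exec_elims:
  "exec orc SKIP s t s'"
  "exec orc (Assign x e) s t s'"
  "exec orc (Query x e) s t s'"
  "exec orc (Seq c1 c2) s t s'"
  "exec orc (Cond e c1 c2) s t s'"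
  "exec orc (While e c) s t s'"

lemma exec_deterministic:
  assumes "exec orc c s t s'" "exec orc c s u s''"
  shows "t = u \<and> s' = s''"
  using assms
proof (induction arbitrary: u s'' rule: exec.induct)
  case (exec_Seq c1 s t1 s1 c2 t2 s2)
  from exec_Seq.prems show ?case by (rule exec_elims) (use exec_Seq.IH in blast)
next
  case (exec_Cond_true e s c1 t s1 c2)
  from exec_Cond_true.prems show ?case
    by (rule exec_elims) (use exec_Cond_true.hyps exec_Cond_true.IH in blast)+
next
  case (exec_Cond_false e s c2 t s1 c1)
  from exec_Cond_false.prems show ?case
    by (rule exec_elims) (use exec_Cond_false.hyps exec_Cond_false.IH in blast)+
next
  case (exec_While_false e s c)
  from exec_While_false.prems show ?case
    by (rule exec_elims) (use exec_While_false.hyps in blast)+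
next
  case (exec_While_true e s c t1 s1 t2 s2)
  from exec_While_true.prems show ?case
    by (rule exec_elims) (use exec_While_true.hyps exec_While_true.IH in blast)+
qed (erule exec_elims, simp)+

text \<open>Input and output are held in variable 0; all other variables are initially \<open>Null\<close>.\<close>

definition decides_within ::
  "com \<Rightarrow> (data \<Rightarrow> data) \<Rightarrow> data \<Rightarrow> bool \<Rightarrow> nat \<Rightarrow> bool" where
  "decides_within c orc d b n \<longleftrightarrow>
     (\<exists>t s. exec orc c ((\<lambda>_. Null)(0 := d)) t s \<and> t \<le> n \<and> (s 0 \<noteq> Null \<longleftrightarrow> b))"


section \<open>Instances of SCFD as input data\<close>

text \<open>
  Attribute names, domain values and lattice elements are symbols, i.e. natural numbers;
  the domains may be infinite. The comparability functions are available through the oracle.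
\<close>

fun comparability_oracle :: "(nat \<Rightarrow> nat \<Rightarrow> nat \<Rightarrow> nat) \<Rightarrow> data \<Rightarrow> data" where
  "comparability_oracle f (Pair (Atom A) (Pair (Atom u) (Atom v))) = Atom (f A u v)"
| "comparability_oracle f _ = Null"

definition enc_list :: "data list \<Rightarrow> data" where
  "enc_list ds = foldr Pair ds Null"

definition enumerates :: "'b list \<Rightarrow> 'b set \<Rightarrow> bool" where
  "enumerates xs S \<longleftrightarrow> distinct xs \<and> set xs = S"

definition enc_attribute :: "nat \<Rightarrow> nat list \<Rightarrow> (nat \<times> nat) list \<Rightarrow> data" where
  "enc_attribute A es ps =
     enc_list [Atom A, enc_list (map Atom es),
       enc_list (map (\<lambda>(x, y). Pair (Atom x) (Atom y)) ps)]"

definition enc_tuple :: "nat list \<Rightarrow> (nat \<Rightarrow> nat) \<Rightarrow> data" where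
  "enc_tuple As t = enc_list (map (\<lambda>A. Atom (t A)) As)"

text \<open>
  All encodings of an instance: sets are listed without repetition in an arbitrary order,
  each lattice is given by its elements and its order relation, and tuples list their values
  in the order in which the attributes are listed.
\<close>

definition scfd_encodings ::
  "nat set \<Rightarrow> (nat \<Rightarrow> nat gorder) \<Rightarrow> (nat \<Rightarrow> nat) set \<Rightarrow> nat set \<Rightarrow> nat \<Rightarrow> data set" where
  "scfd_encodings U L r X A =
     {enc_list [enc_list (map (\<lambda>B. enc_attribute B (elems B) (pairs B)) As),
                enc_list (map (enc_tuple As) ts),
                enc_list (map Atom Xs),
                Atom A] | As elems pairs ts Xs.
       enumerates As U \<and>
       (\<forall>B\<in>U. enumerates (elems B) (carrier (L B)) \<and>
              enumerates (pairs B)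
                {(x, y). x \<in> carrier (L B) \<and> y \<in> carrier (L B) \<and> x \<sqsubseteq>\<^bsub>L B\<^esub> y}) \<and>
       enumerates ts r \<and>
       enumerates Xs X}"

end

theory Submission
  imports Defs
begin

text \<open>
  A homomorphism from a finite bounded lattice to the two-element lattice is the indicator of
  a principal filter \<open>{y. p \<le> y}\<close> whose complement is a principal ideal \<open>{y. y \<le> m}\<close>, and
  every pair \<open>(p, m)\<close> with exactly one of \<open>p \<le> y\<close>, \<open>y \<le> m\<close> for each \<open>y\<close> arises
  in this way. A strong reality chooses such a pair independently for every attribute. Hence
  \<open>X \<rightarrow> A\<close> fails in some strong reality iff there are two tuples such that every attribute
  \<open>B\<close> has a pair \<open>(p, m)\<close> with \<open>p \<le> x\<close> if \<open>B \<in> X\<close> and \<open>\<not> p \<le> x\<close> if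
  \<open>B = A\<close>, where \<open>x\<close> is the comparison of the two values of \<open>B\<close>. As \<open>A \<notin> X\<close>, the two
  requirements concern different attributes. This is a fixed first-order formula whose
  quantifiers range over lists occurring in the input, so nested loops evaluate it in
  polynomial time.
\<close>

section \<open>Strong realities\<close>

lemma two_join: "x \<squnion>\<^bsub>two\<^esub> y \<longleftrightarrow> x \<or> y"
proof -
  interpret two: lattice two by (rule two_lattice)
  have "least two (x \<or> y) (Upper two {x, y})"
    by (auto simp: two_def least_def Upper_def)
  from two.least_unique[OF two.sup_of_two_least this] show ?thesis
    by (simp add: join_def two_def)
qed

lemma two_meet: "x \<sqinter>\<^bsub>two\<^esub> y \<longleftrightarrow> x \<and> y"
proof -
  interpret two: lattice two by (rule two_lattice)
  have "greatest two (x \<and> y) (Lower two {x, y})"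
    by (auto simp: two_def greatest_def Lower_def)
  from two.greatest_unique[OF two.inf_of_two_greatest this] show ?thesis
    by (simp add: meet_def two_def)
qed

lemma carrier_product_order: "carrier (product_order U L) = (\<Pi>\<^sub>E A\<in>U. carrier (L A))"
  by (simp add: product_order_def)

lemma product_order_le: "x \<sqsubseteq>\<^bsub>product_order U L\<^esub> y \<longleftrightarrow> (\<forall>A\<in>U. x A \<sqsubseteq>\<^bsub>L A\<^esub> y A)"
  by (simp add: product_order_def)

lemma product_order_join:
  assumes L: "\<And>A. A \<in> U \<Longrightarrow> lattice (L A)"
    and xy: "x \<in> (\<Pi>\<^sub>E A\<in>U. carrier (L A))" "y \<in> (\<Pi>\<^sub>E A\<in>U. carrier (L A))"
  shows "x \<squnion>\<^bsub>product_order U L\<^esub> y = (\<lambda>A\<in>U. x A \<squnion>\<^bsub>L A\<^esub> y A)"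
proof -
  interpret P: lattice "product_order U L" by (rule product_order_lattice[OF L])
  have "x A \<squnion>\<^bsub>L A\<^esub> y A \<in> carrier (L A) \<and> x A \<sqsubseteq>\<^bsub>L A\<^esub> x A \<squnion>\<^bsub>L A\<^esub> y A \<and>
      y A \<sqsubseteq>\<^bsub>L A\<^esub> x A \<squnion>\<^bsub>L A\<^esub> y A \<and>
      (\<forall>z\<in>carrier (L A). x A \<sqsubseteq>\<^bsub>L A\<^esub> z \<longrightarrow> y A \<sqsubseteq>\<^bsub>L A\<^esub> z \<longrightarrow> x A \<squnion>\<^bsub>L A\<^esub> y A \<sqsubseteq>\<^bsub>L A\<^esub> z)"
    if A: "A \<in> U" for A
  proof -
    interpret lattice "L A" by (rule L[OF A])
    have "x A \<in> carrier (L A)" "y A \<in> carrier (L A)" using xy A by auto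
    then show ?thesis by (simp add: join_left join_right join_le)
  qed
  \<comment> \<open>The componentwise join has the universal property of the join of the product,
    and least elements are unique.\<close>
  then have "least (product_order U L) (\<lambda>A\<in>U. x A \<squnion>\<^bsub>L A\<^esub> y A) (Upper (product_order U L) {x, y})"
    using xy by (simp add: least_def Upper_def product_order_le carrier_product_order PiE_iff)
  from P.least_unique[OF P.sup_of_two_least this] xy show ?thesis
    by (simp add: join_def carrier_product_order)
qed

lemma product_order_meet:
  assumes L: "\<And>A. A \<in> U \<Longrightarrow> lattice (L A)"
    and xy: "x \<in> (\<Pi>\<^sub>E A\<in>U. carrier (L A))" "y \<in> (\<Pi>\<^sub>E A\<in>U. carrier (L A))"
  shows "x \<sqinter>\<^bsub>product_order U L\<^esub> y = (\<lambda>A\<in>U. x A \<sqinter>\<^bsub>L A\<^esub> y A)"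
proof -
  interpret P: lattice "product_order U L" by (rule product_order_lattice[OF L])
  have "x A \<sqinter>\<^bsub>L A\<^esub> y A \<in> carrier (L A) \<and> x A \<sqinter>\<^bsub>L A\<^esub> y A \<sqsubseteq>\<^bsub>L A\<^esub> x A \<and>
      x A \<sqinter>\<^bsub>L A\<^esub> y A \<sqsubseteq>\<^bsub>L A\<^esub> y A \<and>
      (\<forall>z\<in>carrier (L A). z \<sqsubseteq>\<^bsub>L A\<^esub> x A \<longrightarrow> z \<sqsubseteq>\<^bsub>L A\<^esub> y A \<longrightarrow> z \<sqsubseteq>\<^bsub>L A\<^esub> x A \<sqinter>\<^bsub>L A\<^esub> y A)"
    if A: "A \<in> U" for A
  proof -
    interpret lattice "L A" by (rule L[OF A])
    have "x A \<in> carrier (L A)" "y A \<in> carrier (L A)" using xy A by auto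
    then show ?thesis by (simp add: meet_left meet_right meet_le)
  qed
  then have "greatest (product_order U L) (\<lambda>A\<in>U. x A \<sqinter>\<^bsub>L A\<^esub> y A) (Lower (product_order U L) {x, y})"
    using xy by (simp add: greatest_def Lower_def product_order_le carrier_product_order PiE_iff)
  from P.greatest_unique[OF P.inf_of_two_greatest this] xy show ?thesis
    by (simp add: meet_def carrier_product_order)
qed

section \<open>Two-valued homomorphisms of a finite bounded lattice\<close>

definition splits :: "('l, 'e) gorder_scheme \<Rightarrow> 'l \<Rightarrow> 'l \<Rightarrow> bool" where
  "splits L p m \<longleftrightarrow> p \<in> carrier L \<and> m \<in> carrier L \<and>
     (\<forall>y\<in>carrier L. (p \<sqsubseteq>\<^bsub>L\<^esub> y) \<noteq> (y \<sqsubseteq>\<^bsub>L\<^esub> m))"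

definition two_valued_hom :: "('l, 'e) gorder_scheme \<Rightarrow> ('l \<Rightarrow> bool) \<Rightarrow> bool" where
  "two_valued_hom L h \<longleftrightarrow> h \<bottom>\<^bsub>L\<^esub> = False \<and> h \<top>\<^bsub>L\<^esub> = True \<and>
     (\<forall>x\<in>carrier L. \<forall>y\<in>carrier L. h (x \<squnion>\<^bsub>L\<^esub> y) = (h x \<or> h y) \<and> h (x \<sqinter>\<^bsub>L\<^esub> y) = (h x \<and> h y))"

context bounded_lattice
begin

text \<open>Every principal filter respects meets. Joins are respected because the complement of the
  filter is the principal ideal below \<open>m\<close>, and \<open>x \<squnion> y\<close> lies in
  that ideal iff both \<open>x\<close> and \<open>y\<close> do.\<close>

lemma splits_hom:
  assumes "splits L p m"
  shows "two_valued_hom L (\<lambda>y. p \<sqsubseteq> y)"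
proof -
  have pm: "p \<in> carrier L" "m \<in> carrier L" "\<And>y. y \<in> carrier L \<Longrightarrow> p \<sqsubseteq> y \<longleftrightarrow> \<not> y \<sqsubseteq> m"
    using assms by (auto simp: splits_def)
  show ?thesis
    unfolding two_valued_hom_def
  proof (intro conjI ballI)
    fix x y assume xy: "x \<in> carrier L" "y \<in> carrier L"
    have "x \<squnion> y \<sqsubseteq> m \<longleftrightarrow> x \<sqsubseteq> m \<and> y \<sqsubseteq> m"
      using xy pm(2) by (meson join_closed join_le join_left join_right le_trans)
    with xy pm(3) show "(p \<sqsubseteq> x \<squnion> y) = (p \<sqsubseteq> x \<or> p \<sqsubseteq> y)" by auto
    show "(p \<sqsubseteq> x \<sqinter> y) = (p \<sqsubseteq> x \<and> p \<sqsubseteq> y)"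
      using xy pm(1) by (meson meet_closed meet_le meet_left meet_right le_trans)
  qed (use pm in auto)
qed

text \<open>In a finite lattice the elements mapped to true have a least element \<open>p\<close>,
  and those mapped to false have a greatest element \<open>m\<close>. A lattice has at most
  quadratically many pairs \<open>(p, m)\<close>, so this reduces the quantifier over homomorphisms
  to a small search.\<close>

lemma hom_splits:
  assumes fin: "finite (carrier L)" and h: "two_valued_hom L h"
  obtains p m where "splits L p m" "\<And>y. y \<in> carrier L \<Longrightarrow> h y \<longleftrightarrow> p \<sqsubseteq> y"
proof -
  have bounds: "h \<top>" "\<not> h \<bottom>"
    and meet: "\<And>x y. x \<in> carrier L \<Longrightarrow> y \<in> carrier L \<Longrightarrow> h (x \<sqinter> y) \<longleftrightarrow> h x \<and> h y"
    and join: "\<And>x y. x \<in> carrier L \<Longrightarrow> y \<in> carrier L \<Longrightarrow> h (x \<squnion> y) \<longleftrightarrow> h x \<or> h y"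
    using h by (simp_all add: two_valued_hom_def)
  \<comment> \<open>Meets are taken one element at a time, starting from the top. The bound found
    stays in the filter because \<open>h\<close> preserves meets, so taking the whole filter for
    \<open>S\<close> yields its least element.\<close>
  have "\<exists>p\<in>carrier L. h p \<and> (\<forall>y\<in>S. p \<sqsubseteq> y)"
    if "finite S" "\<forall>y\<in>S. y \<in> carrier L \<and> h y" for S
    using that
  proof (induction S)
    case empty
    show ?case using bounds(1) by (intro bexI[of _ "\<top>"]) simp_all
  next
    case (insert x S)
    then obtain p where p: "p \<in> carrier L" "h p" "\<forall>y\<in>S. p \<sqsubseteq> y" by auto
    have x: "x \<in> carrier L" "h x" using insert.prems by simp_all
    have "x \<sqinter> p \<sqsubseteq> y" if "y \<in> S" for y
      using le_trans[OF meet_right[of x p], of y] that p x insert.prems by simp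
    with p x show ?case
      by (intro bexI[of _ "x \<sqinter> p"]) (simp_all add: meet meet_left)
  qed
  then have "\<exists>p\<in>carrier L. h p \<and> (\<forall>y\<in>{y \<in> carrier L. h y}. p \<sqsubseteq> y)"
    by this (use fin in auto)
  then obtain p where p: "p \<in> carrier L" "h p" "\<And>y. y \<in> carrier L \<Longrightarrow> h y \<Longrightarrow> p \<sqsubseteq> y" by blast
  \<comment> \<open>Dually, with joins and starting from the bottom.\<close>
  have "\<exists>m\<in>carrier L. \<not> h m \<and> (\<forall>y\<in>S. y \<sqsubseteq> m)"
    if "finite S" "\<forall>y\<in>S. y \<in> carrier L \<and> \<not> h y" for S
    using that
  proof (induction S)
    case empty
    show ?case using bounds(2) by (intro bexI[of _ "\<bottom>"]) simp_all
  next
    case (insert x S)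
    then obtain m where m: "m \<in> carrier L" "\<not> h m" "\<forall>y\<in>S. y \<sqsubseteq> m" by auto
    have x: "x \<in> carrier L" "\<not> h x" using insert.prems by simp_all
    have "y \<sqsubseteq> x \<squnion> m" if "y \<in> S" for y
      using le_trans[OF _ join_right[of x m], of y] that m x insert.prems by simp
    with m x show ?case
      by (intro bexI[of _ "x \<squnion> m"]) (simp_all add: join join_left)
  qed
  then have "\<exists>m\<in>carrier L. \<not> h m \<and> (\<forall>y\<in>{y \<in> carrier L. \<not> h y}. y \<sqsubseteq> m)"
    by this (use fin in auto)
  then obtain m where m: "m \<in> carrier L" "\<not> h m" "\<And>y. y \<in> carrier L \<Longrightarrow> \<not> h y \<Longrightarrow> y \<sqsubseteq> m" by blast
  \<comment> \<open>With monotonicity, \<open>h\<close> is true on everything above \<open>p\<close>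
    and false on everything below \<open>m\<close>, which gives the converse halves of both
    equivalences.\<close>
  have mono: "h y" if "x \<in> carrier L" "y \<in> carrier L" "x \<sqsubseteq> y" "h x" for x y
  proof -
    have "x \<sqinter> y = x" using that le_iff_join by simp
    with meet[of x y] that show ?thesis by simp
  qed
  show thesis
  proof (rule that[of p m])
    show iff: "h y \<longleftrightarrow> p \<sqsubseteq> y" if "y \<in> carrier L" for y
      using that p mono by blast
    have "y \<sqsubseteq> m \<longleftrightarrow> \<not> h y" if "y \<in> carrier L" for y
      using that m mono by blast
    with iff p m show "splits L p m" by (simp add: splits_def)
  qed
qed

end

section \<open>Strong realities as families of homomorphisms\<close>

lemma hom_attribute_interpretation:
  assumes "bounded_lattice L" and h: "two_valued_hom L h"
  shows "attribute_interpretation L h"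
proof -
  interpret bounded_lattice L by fact
  have "isotone L two h"
  proof (rule isotoneI)
    show "weak_partial_order two"
      using two_lattice by (simp add: lattice_def upper_semilattice_def partial_order_def)
    fix x y assume xy: "x \<in> carrier L" "y \<in> carrier L" "x \<sqsubseteq>\<^bsub>L\<^esub> y"
    \<comment> \<open>The order is expressed by an equation between meets, to which preservation of
      meets applies.\<close>
    then have "x \<sqinter>\<^bsub>L\<^esub> y = x" using le_iff_join by simp
    moreover have "h (x \<sqinter>\<^bsub>L\<^esub> y) = (h x \<and> h y)"
      using h xy unfolding two_valued_hom_def by blast
    ultimately have "h x \<longrightarrow> h y" by metis
    then show "h x \<sqsubseteq>\<^bsub>two\<^esub> h y"
      by (simp add: two_def)
  qed (rule weak_partial_order_axioms)
  with h show ?thesis by (simp add: attribute_interpretation_def two_valued_hom_def)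
qed

text \<open>Joins and meets of the product are componentwise, so the homomorphism condition on
  \<open>g\<close> splits into one condition per attribute. The attributes can therefore be treated
  independently.\<close>

lemma strong_reality_iff:
  assumes L: "\<And>A. A \<in> U \<Longrightarrow> bounded_lattice (L A)"
  shows "strong_reality U L g \<longleftrightarrow>
    (\<exists>h. (\<forall>A\<in>U. two_valued_hom (L A) (h A)) \<and>
      g = (\<lambda>x\<in>(\<Pi>\<^sub>E A\<in>U. carrier (L A)). \<lambda>A\<in>U. h A (x A)))"
proof -
  let ?car = "\<Pi>\<^sub>E A\<in>U. carrier (L A)"
  have lat: "lattice (L A)" if "A \<in> U" for A
    using L[OF that] by (simp add: bounded_lattice_def)
  note join = product_order_join[OF lat] product_order_join[of U "\<lambda>_. two", OF two_lattice]
  note meet = product_order_meet[OF lat] product_order_meet[of U "\<lambda>_. two", OF two_lattice]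
  have two_car: "carrier two = UNIV" by (simp add: two_def)
  have cong: "restrict a U = restrict b U \<longleftrightarrow> (\<forall>A\<in>U. a A = b A)" for a b :: "_ \<Rightarrow> bool"
    by (auto simp: restrict_def fun_eq_iff)
  have closed: "x A \<squnion>\<^bsub>L A\<^esub> y A \<in> carrier (L A)" "x A \<sqinter>\<^bsub>L A\<^esub> y A \<in> carrier (L A)"
    if "x \<in> ?car" "y \<in> ?car" "A \<in> U" for x y A
  proof -
    interpret lattice "L A" using lat that by blast
    have "x A \<in> carrier (L A)" "y A \<in> carrier (L A)" using that by auto
    then show "x A \<squnion>\<^bsub>L A\<^esub> y A \<in> carrier (L A)" "x A \<sqinter>\<^bsub>L A\<^esub> y A \<in> carrier (L A)"
      by simp_all
  qed
  have pres: "join_pres (product_order U L) (product_order U (\<lambda>_. two)) (\<lambda>x\<in>?car. \<lambda>A\<in>U. h A (x A)) \<longleftrightarrow>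
      (\<forall>x\<in>?car. \<forall>y\<in>?car. \<forall>A\<in>U. h A (x A \<squnion>\<^bsub>L A\<^esub> y A) = (h A (x A) \<or> h A (y A)))"
    "meet_pres (product_order U L) (product_order U (\<lambda>_. two)) (\<lambda>x\<in>?car. \<lambda>A\<in>U. h A (x A)) \<longleftrightarrow>
      (\<forall>x\<in>?car. \<forall>y\<in>?car. \<forall>A\<in>U. h A (x A \<sqinter>\<^bsub>L A\<^esub> y A) = (h A (x A) \<and> h A (y A)))" for h
    unfolding join_pres_def meet_pres_def
    by (simp_all add: product_order_lattice lat two_lattice carrier_product_order join meet
        two_car two_join two_meet closed cong)
  \<comment> \<open>Every lattice element is a coordinate of some vector, here one filled up with
    tops. This turns laws for vectors into laws for the elements of a single lattice.\<close>
  have ext: "\<exists>x\<in>?car. x A = u" if "A \<in> U" "u \<in> carrier (L A)" for A u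
  proof (intro bexI)
    have "\<top>\<^bsub>L B\<^esub> \<in> carrier (L B)" if "B \<in> U" for B
    proof -
      interpret bounded_lattice "L B" by (rule L[OF that])
      show ?thesis by simp
    qed
    with that show "(\<lambda>B\<in>U. if B = A then u else \<top>\<^bsub>L B\<^esub>) \<in> ?car" by auto
  qed (use that in simp)
  show ?thesis
  proof
    assume "strong_reality U L g"
    then obtain h where h: "\<forall>A\<in>U. attribute_interpretation (L A) (h A)"
      and g: "g = (\<lambda>x\<in>?car. \<lambda>A\<in>U. h A (x A))"
      and gj: "join_pres (product_order U L) (product_order U (\<lambda>_. two)) g"
      and gm: "meet_pres (product_order U L) (product_order U (\<lambda>_. two)) g"
      by (auto simp: strong_reality_def schema_interpretation_def carrier_product_order)
    have "two_valued_hom (L A) (h A)" if A: "A \<in> U" for A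
      unfolding two_valued_hom_def
    proof (intro conjI ballI)
      fix u v assume "u \<in> carrier (L A)" "v \<in> carrier (L A)"
      then obtain x y where "x \<in> ?car" "x A = u" "y \<in> ?car" "y A = v"
        using ext[OF A] by metis
      then show "h A (u \<squnion>\<^bsub>L A\<^esub> v) = (h A u \<or> h A v)" "h A (u \<sqinter>\<^bsub>L A\<^esub> v) = (h A u \<and> h A v)"
        using gj gm A unfolding g pres by blast+
    qed (use h A in \<open>auto simp: attribute_interpretation_def\<close>)
    with g show "\<exists>h. (\<forall>A\<in>U. two_valued_hom (L A) (h A)) \<and> g = (\<lambda>x\<in>?car. \<lambda>A\<in>U. h A (x A))"
      by blast
  next
    assume "\<exists>h. (\<forall>A\<in>U. two_valued_hom (L A) (h A)) \<and> g = (\<lambda>x\<in>?car. \<lambda>A\<in>U. h A (x A))"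
    then obtain h where h: "\<forall>A\<in>U. two_valued_hom (L A) (h A)"
      and g: "g = (\<lambda>x\<in>?car. \<lambda>A\<in>U. h A (x A))" by blast
    have "schema_interpretation U L g"
      unfolding schema_interpretation_def carrier_product_order g
      using h L hom_attribute_interpretation by (intro exI[of _ h] conjI refl) blast
    moreover have "join_pres (product_order U L) (product_order U (\<lambda>_. two)) g"
      "meet_pres (product_order U L) (product_order U (\<lambda>_. two)) g"
      unfolding g pres using h by (auto simp: two_valued_hom_def PiE_iff)
    ultimately show "strong_reality U L g" by (simp add: strong_reality_def)
  qed
qed

section \<open>Refutation by a pair of tuples\<close>

context schema_context
begin

lemma comparison_closed:
  assumes r: "is_relation U D r" and "t1 \<in> r" "t2 \<in> r" and B: "B \<in> U"
  shows "f B (t1 B) (t2 B) \<in> carrier (L B)"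
proof -
  have "t1 B \<in> D B" "t2 B \<in> D B"
    using r \<open>t1 \<in> r\<close> \<open>t2 \<in> r\<close> B by (auto simp: is_relation_def PiE_iff)
  with comparability_onto[OF B] show ?thesis by force
qed

text \<open>The choice of a reality and the choice of two tuples are both existential, so the tuples
  may be fixed first; then the pairs are chosen attribute by attribute. An attribute outside
  \<open>X\<close> and different from \<open>A\<close> must still have a pair: without one there is
  no strong reality and certainty is vacuous.\<close>

lemma strongly_certain_iff:
  assumes r: "is_relation U D r" and fd: "is_fd U X A"
  shows "strongly_certain U L f r X A \<longleftrightarrow>
    \<not> (\<exists>t1\<in>r. \<exists>t2\<in>r. \<forall>B\<in>U. \<exists>p m. splits (L B) p m \<and>
        (B \<in> X \<longrightarrow> p \<sqsubseteq>\<^bsub>L B\<^esub> f B (t1 B) (t2 B)) \<and>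
        (B = A \<longrightarrow> \<not> p \<sqsubseteq>\<^bsub>L B\<^esub> f B (t1 B) (t2 B)))" (is "_ \<longleftrightarrow> \<not> ?R")
proof -
  let ?car = "\<Pi>\<^sub>E A\<in>U. carrier (L A)"
  have car: "compare_tuples U f t1 t2 \<in> ?car" if "t1 \<in> r" "t2 \<in> r" for t1 t2
    using comparison_closed[OF r that] by (auto simp: compare_tuples_def)
  have models: "models_fd U f r (\<lambda>x\<in>?car. \<lambda>B\<in>U. h B (x B)) X A \<longleftrightarrow>
      (\<forall>t1\<in>r. \<forall>t2\<in>r. (\<forall>B\<in>X. h B (f B (t1 B) (t2 B))) \<longrightarrow> h A (f A (t1 A) (t2 A)))" for h
  proof -
    have "as_subset U ((\<lambda>x\<in>?car. \<lambda>B\<in>U. h B (x B)) (compare_tuples U f t1 t2)) =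
        {B \<in> U. h B (f B (t1 B) (t2 B))}" if "t1 \<in> r" "t2 \<in> r" for t1 t2
      using car[OF that] by (auto simp: as_subset_def compare_tuples_def)
    moreover have "models_fd U f r g X A \<longleftrightarrow> (\<forall>t1\<in>r. \<forall>t2\<in>r.
        X \<subseteq> as_subset U (g (compare_tuples U f t1 t2)) \<longrightarrow>
        A \<in> as_subset U (g (compare_tuples U f t1 t2)))" for g
      unfolding models_fd_def comparisons_def by blast
    moreover have "A \<in> U" "X \<subseteq> {B \<in> U. P B} \<longleftrightarrow> (\<forall>B\<in>X. P B)" for P
      using fd unfolding is_fd_def by blast+
    ultimately show ?thesis by simp
  qed
  have real_iff: "strong_reality U L g \<longleftrightarrow> (\<exists>h. (\<forall>A\<in>U. two_valued_hom (L A) (h A)) \<and>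
      g = (\<lambda>x\<in>?car. \<lambda>A\<in>U. h A (x A)))" for g
    by (rule strong_reality_iff) (rule lattice)
  show ?thesis
  proof
    assume cert: "strongly_certain U L f r X A"
    show "\<not> ?R"
    proof
      assume ?R
      then obtain t1 t2 where t: "t1 \<in> r" "t2 \<in> r" and
        "\<forall>B\<in>U. \<exists>p m. splits (L B) p m \<and> (B \<in> X \<longrightarrow> p \<sqsubseteq>\<^bsub>L B\<^esub> f B (t1 B) (t2 B)) \<and>
          (B = A \<longrightarrow> \<not> p \<sqsubseteq>\<^bsub>L B\<^esub> f B (t1 B) (t2 B))"
        by blast
      \<comment> \<open>One pair per attribute is chosen; the filters above the \<open>p B\<close>
        together form the refuting reality.\<close>
      then obtain p m where pm: "\<And>B. B \<in> U \<Longrightarrow> splits (L B) (p B) (m B) \<and>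
          (B \<in> X \<longrightarrow> p B \<sqsubseteq>\<^bsub>L B\<^esub> f B (t1 B) (t2 B)) \<and>
          (B = A \<longrightarrow> \<not> p B \<sqsubseteq>\<^bsub>L B\<^esub> f B (t1 B) (t2 B))"
        by metis
      have "\<forall>B\<in>U. two_valued_hom (L B) (\<lambda>y. p B \<sqsubseteq>\<^bsub>L B\<^esub> y)"
      proof
        fix B assume "B \<in> U"
        with pm show "two_valued_hom (L B) (\<lambda>y. p B \<sqsubseteq>\<^bsub>L B\<^esub> y)"
          by (intro bounded_lattice.splits_hom[OF lattice, of B "p B" "m B"]) simp_all
      qed
      then have "strong_reality U L (\<lambda>x\<in>?car. \<lambda>B\<in>U. p B \<sqsubseteq>\<^bsub>L B\<^esub> x B)"
        unfolding real_iff by (intro exI[of _ "\<lambda>B y. p B \<sqsubseteq>\<^bsub>L B\<^esub> y"] conjI refl)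
      with cert have "models_fd U f r (\<lambda>x\<in>?car. \<lambda>B\<in>U. p B \<sqsubseteq>\<^bsub>L B\<^esub> x B) X A"
        by (simp add: strongly_certain_def)
      moreover have "\<forall>B\<in>X. p B \<sqsubseteq>\<^bsub>L B\<^esub> f B (t1 B) (t2 B)" "\<not> p A \<sqsubseteq>\<^bsub>L A\<^esub> f A (t1 A) (t2 A)"
        using pm fd by (auto simp: is_fd_def)
      ultimately show False
        using t unfolding models[of "\<lambda>B y. p B \<sqsubseteq>\<^bsub>L B\<^esub> y"] by blast
    qed
  next
    assume R: "\<not> ?R"
    show "strongly_certain U L f r X A"
      unfolding strongly_certain_def
    proof (intro allI impI)
      fix g assume "strong_reality U L g"
      then obtain h where h: "\<forall>B\<in>U. two_valued_hom (L B) (h B)"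
        and g: "g = (\<lambda>x\<in>?car. \<lambda>B\<in>U. h B (x B))"
        unfolding real_iff by blast
      show "models_fd U f r g X A"
        unfolding g models
      proof (intro ballI impI, rule ccontr)
        fix t1 t2
        assume t: "t1 \<in> r" "t2 \<in> r" and X: "\<forall>B\<in>X. h B (f B (t1 B) (t2 B))"
          and A: "\<not> h A (f A (t1 A) (t2 A))"
        have "\<exists>p m. splits (L B) p m \<and> (B \<in> X \<longrightarrow> p \<sqsubseteq>\<^bsub>L B\<^esub> f B (t1 B) (t2 B)) \<and>
          (B = A \<longrightarrow> \<not> p \<sqsubseteq>\<^bsub>L B\<^esub> f B (t1 B) (t2 B))" if B: "B \<in> U" for B
        proof -
          have "f B (t1 B) (t2 B) \<in> carrier (L B)"
            by (rule comparison_closed[OF r t B])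
          moreover obtain p m where "splits (L B) p m"
            "\<And>y. y \<in> carrier (L B) \<Longrightarrow> h B y \<longleftrightarrow> p \<sqsubseteq>\<^bsub>L B\<^esub> y"
            using bounded_lattice.hom_splits[OF lattice[OF B] finite_lattice[OF B] h[rule_format, OF B]]
            by blast
          ultimately show ?thesis using X A by blast
        qed
        with t R show False by blast
      qed
    qed
  qed
qed

end

section \<open>Compiling formulas with bounded quantifiers\<close>

text \<open>Total correctness with a time budget. As \<open>n\<close> is only an upper bound,
  budgets of subprograms can be added without exact step counts.\<close>

definition runs :: "(data \<Rightarrow> data) \<Rightarrow> com \<Rightarrow> store \<Rightarrow> nat \<Rightarrow> (store \<Rightarrow> bool) \<Rightarrow> bool" where
  "runs orc c s n Q \<longleftrightarrow> (\<exists>t s'. exec orc c s t s' \<and> t \<le> n \<and> Q s')"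

lemma runs_mono:
  "runs orc c s n Q \<Longrightarrow> n \<le> n' \<Longrightarrow> (\<And>s'. Q s' \<Longrightarrow> Q' s') \<Longrightarrow> runs orc c s n' Q'"
  unfolding runs_def by (meson order_trans)

lemma runs_SKIP: "Q s \<Longrightarrow> 1 \<le> n \<Longrightarrow> runs orc SKIP s n Q"
  unfolding runs_def by (blast intro: exec_SKIP)

lemma runs_Assign: "Q (s(x := eval e s)) \<Longrightarrow> Suc (eval_cost e) \<le> n \<Longrightarrow> runs orc (Assign x e) s n Q"
  unfolding runs_def by (blast intro: exec_Assign)

lemma runs_Query: "Q (s(x := orc (eval e s))) \<Longrightarrow> Suc (eval_cost e) \<le> n \<Longrightarrow> runs orc (Query x e) s n Q"
  unfolding runs_def by (blast intro: exec_Query)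

lemma runs_Seq:
  assumes "runs orc c1 s n1 P" "\<And>s'. P s' \<Longrightarrow> runs orc c2 s' n2 Q" "n1 + n2 \<le> n"
  shows "runs orc (Seq c1 c2) s n Q"
  using assms unfolding runs_def by (meson add_mono exec_Seq order_trans)

lemma runs_Assign_Seq:
  assumes "runs orc c (s(x := eval e s)) n' Q" "Suc (eval_cost e) + n' \<le> n"
  shows "runs orc (Seq (Assign x e) c) s n Q"
  by (rule runs_Seq[where P = "\<lambda>s'. s' = s(x := eval e s)", OF runs_Assign]) (use assms in auto)

lemma runs_Cond:
  assumes "eval e s \<noteq> Null \<Longrightarrow> runs orc c1 s n' Q" "eval e s = Null \<Longrightarrow> runs orc c2 s n' Q"
    "Suc (eval_cost e + n') \<le> n"
  shows "runs orc (Cond e c1 c2) s n Q"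
proof (cases "eval e s = Null")
  case True
  with assms(2) obtain t s' where "exec orc c2 s t s'" "t \<le> n'" "Q s'"
    unfolding runs_def by blast
  with True assms(3) show ?thesis
    unfolding runs_def by (intro exI[of _ "Suc (eval_cost e + t)"] exI[of _ s']) (auto intro: exec_Cond_false)
next
  case False
  with assms(1) obtain t s' where "exec orc c1 s t s'" "t \<le> n'" "Q s'"
    unfolding runs_def by blast
  with False assms(3) show ?thesis
    unfolding runs_def by (intro exI[of _ "Suc (eval_cost e + t)"] exI[of _ s']) (auto intro: exec_Cond_true)
qed

lemma runs_While_false:
  "eval e s = Null \<Longrightarrow> Q s \<Longrightarrow> Suc (eval_cost e) \<le> n \<Longrightarrow> runs orc (While e c) s n Q"
  unfolding runs_def by (blast intro: exec_While_false)

lemma runs_While_true: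
  assumes "eval e s \<noteq> Null" "runs orc c s n1 P" "\<And>s'. P s' \<Longrightarrow> runs orc (While e c) s' n2 Q"
    "Suc (eval_cost e + n1 + n2) \<le> n"
  shows "runs orc (While e c) s n Q"
proof -
  from assms(2) obtain t1 s1 where 1: "exec orc c s t1 s1" "t1 \<le> n1" "P s1"
    unfolding runs_def by blast
  from assms(3)[OF 1(3)] obtain t2 s2 where 2: "exec orc (While e c) s1 t2 s2" "t2 \<le> n2" "Q s2"
    unfolding runs_def by blast
  show ?thesis
    unfolding runs_def using exec_While_true[OF assms(1) 1(1) 2(1)] 1 2 assms(4)
    by (intro exI conjI) (assumption, auto)
qed

text \<open>
  A formula at level \<open>n\<close> speaks about the variables below \<open>n\<close>. \<open>Some_in e1 e2 e3 \<phi>\<close> walks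
  through three lists in lockstep and binds the variables \<open>n\<close>, \<open>n + 1\<close>, \<open>n + 2\<close> to their
  current non-empty suffixes (not to their elements); \<open>Ask\<close> binds variable \<open>n\<close> to the answer
  of the oracle. The compiled program leaves the truth value in variable \<open>n\<close>.
\<close>

datatype formula =
    Same expr expr
  | Neg formula
  | Conj formula formula
  | Some_in expr expr expr formula
  | Ask expr formula

text \<open>The clause for atoms follows the compiled loop: it stops only at \<open>Null\<close>,
  and the tail of an atom is \<open>Null\<close>, so an atom receives exactly one iteration.\<close>

fun some_suffix :: "(data \<Rightarrow> data \<Rightarrow> data \<Rightarrow> bool) \<Rightarrow> data \<Rightarrow> data \<Rightarrow> data \<Rightarrow> bool" where
  "some_suffix P Null y z = False"
| "some_suffix P (Atom k) y z = P (Atom k) y z"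
| "some_suffix P (Pair a x) y z = (P (Pair a x) y z \<or> some_suffix P x (tail y) (tail z))"

fun sat :: "(data \<Rightarrow> data) \<Rightarrow> nat \<Rightarrow> formula \<Rightarrow> store \<Rightarrow> bool" where
  "sat orc n (Same e e') s = leaf_eq (eval e s) (eval e' s)"
| "sat orc n (Neg \<phi>) s = (\<not> sat orc n \<phi> s)"
| "sat orc n (Conj \<phi> \<psi>) s = (sat orc n \<phi> s \<and> sat orc n \<psi> s)"
| "sat orc n (Some_in e1 e2 e3 \<phi>) s =
    some_suffix (\<lambda>x y z. sat orc (n + 3) \<phi> (s(n := x, n + 1 := y, n + 2 := z)))
      (eval e1 s) (eval e2 s) (eval e3 s)"
| "sat orc n (Ask e \<phi>) s = sat orc (n + 1) \<phi> (s(n := orc (eval e s)))"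

fun reads_below :: "nat \<Rightarrow> expr \<Rightarrow> bool" where
  "reads_below n (Var i) = (i < n)"
| "reads_below n NULL = True"
| "reads_below n (PAIR e e') = (reads_below n e \<and> reads_below n e')"
| "reads_below n (HEAD e) = reads_below n e"
| "reads_below n (TAIL e) = reads_below n e"
| "reads_below n (EQ e e') = (reads_below n e \<and> reads_below n e')"

text \<open>
  Lists are given by selectors, so that every value bound during a run has at most the size
  of the input, and the bound on the number of iterations does not depend on the nesting.
\<close>

fun selector :: "expr \<Rightarrow> bool" where
  "selector (Var i) = True"
| "selector NULL = True"
| "selector (HEAD e) = selector e"
| "selector (TAIL e) = selector e"
| "selector (PAIR e e') = False"
| "selector (EQ e e') = False"

fun well_scoped :: "nat \<Rightarrow> formula \<Rightarrow> bool" where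
  "well_scoped n (Same e e') = (reads_below n e \<and> reads_below n e')"
| "well_scoped n (Neg \<phi>) = well_scoped n \<phi>"
| "well_scoped n (Conj \<phi> \<psi>) = (well_scoped n \<phi> \<and> well_scoped n \<psi>)"
| "well_scoped n (Some_in e1 e2 e3 \<phi>) =
    ((\<forall>e\<in>{e1, e2, e3}. reads_below n e \<and> selector e) \<and> well_scoped (n + 3) \<phi>)"
| "well_scoped n (Ask e \<phi>) = (reads_below n e \<and> well_scoped (n + 1) \<phi>)"

text \<open>The body \<open>c\<close> leaves its verdict in variable \<open>n + 3\<close>. After a
  hit the cursor \<open>n\<close> is cleared, which ends the loop while the verdict
  survives.\<close>

definition search_step :: "nat \<Rightarrow> com \<Rightarrow> com" where
  "search_step n c = Seq c
     (Cond (Var (n + 3))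
       (Assign n NULL)
       (Seq (Assign n (TAIL (Var n)))
         (Seq (Assign (n + 1) (TAIL (Var (n + 1)))) (Assign (n + 2) (TAIL (Var (n + 2)))))))"

fun compile :: "nat \<Rightarrow> formula \<Rightarrow> com" where
  "compile n (Same e e') = Assign n (EQ e e')"
| "compile n (Neg \<phi>) = Seq (compile n \<phi>) (Assign n (EQ (Var n) NULL))"
| "compile n (Conj \<phi> \<psi>) = Seq (compile n \<phi>) (Cond (Var n) (compile n \<psi>) SKIP)"
| "compile n (Some_in e1 e2 e3 \<phi>) =
    Seq (Assign n e1) (Seq (Assign (n + 1) e2) (Seq (Assign (n + 2) e3) (Seq (Assign (n + 3) NULL)
      (Seq
        (While (Var n) (search_step n (compile (n + 3) \<phi>)))
        (Assign n (Var (n + 3)))))))"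
| "compile n (Ask e \<phi>) =
    Seq (Query n e) (Seq (compile (n + 1) \<phi>) (Assign n (Var (n + 1))))"

text \<open>The indeterminate stands for a bound on the size of all stored values, hence also on the
  iterations of each loop. The 13 per iteration are 11 steps of \<open>search_step\<close> besides
  its body and 2 for the loop test.\<close>

fun time :: "formula \<Rightarrow> nat poly" where
  "time (Same e e') = [:Suc (Suc (eval_cost e + eval_cost e')):]"
| "time (Neg \<phi>) = time \<phi> + [:4:]"
| "time (Conj \<phi> \<psi>) = time \<phi> + time \<psi> + [:3:]"
| "time (Some_in e1 e2 e3 \<phi>) =
    [:eval_cost e1 + eval_cost e2 + eval_cost e3 + 9:] + [:0, 1:] * (time \<phi> + [:13:])"
| "time (Ask e \<phi>) = time \<phi> + [:eval_cost e + 3:]"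

section \<open>Dependence on low variables and size bounds\<close>

lemma eval_cong: "reads_below n e \<Longrightarrow> \<forall>i<n. s i = s' i \<Longrightarrow> eval e s = eval e s'"
  by (induction e) auto

lemma sat_cong: "well_scoped n \<phi> \<Longrightarrow> \<forall>i<n. s i = s' i \<Longrightarrow> sat orc n \<phi> s = sat orc n \<phi> s'"
proof (induction \<phi> arbitrary: n s s')
  case (Same e e')
  then show ?case using eval_cong[of n _ s s'] by auto
next
  case (Conj \<phi> \<psi>)
  show ?case
    using Conj.prems Conj.IH(1)[of n s s'] Conj.IH(2)[of n s s'] by simp
next
  case (Some_in e1 e2 e3 \<phi>)
  have "eval e s = eval e s'" if "e \<in> {e1, e2, e3}" for e
    using Some_in.prems that by (intro eval_cong[of n]) auto
  moreover have "sat orc (n + 3) \<phi> (s(n := x, n + 1 := y, n + 2 := z)) =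
      sat orc (n + 3) \<phi> (s'(n := x, n + 1 := y, n + 2 := z))" for x y z
    using Some_in.prems by (intro Some_in.IH) auto
  ultimately show ?case by simp
next
  case (Ask e \<phi>)
  have "eval e s = eval e s'"
    using Ask.prems by (intro eval_cong[of n]) auto
  moreover have "sat orc (n + 1) \<phi> (s(n := x)) = sat orc (n + 1) \<phi> (s'(n := x))" for x
    using Ask.prems by (intro Ask.IH) auto
  ultimately show ?case by simp
qed auto

lemma data_size_pos: "1 \<le> data_size x"
  by (cases x) auto

lemma data_size_head: "data_size (head x) \<le> data_size x"
  by (cases x) auto

lemma data_size_tail: "data_size (tail x) \<le> data_size x"
  by (cases x) auto

lemma data_size_selector:
  assumes "selector e" "reads_below n e" "\<forall>i<n. data_size (s i) \<le> M" "1 \<le> M"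
  shows "data_size (eval e s) \<le> M"
  using assms
proof (induction e)
  case (HEAD e)
  then show ?case using data_size_head[of "eval e s"] by auto
next
  case (TAIL e)
  then show ?case using data_size_tail[of "eval e s"] by auto
qed auto

lemma leaf_eq_Null: "leaf_eq x Null \<longleftrightarrow> x = Null"
  by (cases x) auto

lemma of_truth_eq_Null: "of_truth b = Null \<longleftrightarrow> \<not> b"
  by (simp add: of_truth_def)

section \<open>Correctness and running time of compiled programs\<close>

lemma runs_search_step:
  assumes body: "runs orc c s C (\<lambda>s'. (\<forall>i<n+3. s' i = s i) \<and> (s' (n + 3) \<noteq> Null \<longleftrightarrow> found))"
  shows "runs orc (search_step n c) s (C + 11)
      (\<lambda>s'. (\<forall>i<n. s' i = s i) \<and>
        (if found then s' n = Null \<and> s' (n + 3) \<noteq> Null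
         else s' n = tail (s n) \<and> s' (n + 1) = tail (s (n + 1)) \<and> s' (n + 2) = tail (s (n + 2)) \<and>
           s' (n + 3) = Null))"
  unfolding search_step_def
proof (rule runs_Seq[OF body])
  fix s' assume s': "(\<forall>i<n+3. s' i = s i) \<and> (s' (n + 3) \<noteq> Null \<longleftrightarrow> found)"
  show "runs orc
      (Cond (Var (n + 3))
        (Assign n NULL)
        (Seq (Assign n (TAIL (Var n)))
          (Seq (Assign (n + 1) (TAIL (Var (n + 1)))) (Assign (n + 2) (TAIL (Var (n + 2)))))))
      s' 11
      (\<lambda>s'. (\<forall>i<n. s' i = s i) \<and>
        (if found then s' n = Null \<and> s' (n + 3) \<noteq> Null
         else s' n = tail (s n) \<and> s' (n + 1) = tail (s (n + 1)) \<and> s' (n + 2) = tail (s (n + 2)) \<and>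
           s' (n + 3) = Null))"
    by (rule runs_Cond[where n' = 9],
        (rule runs_Assign, use s' in simp, simp),
        (rule runs_Assign_Seq[where n' = 6], rule runs_Assign_Seq[where n' = 3],
          rule runs_Assign, use s' in simp_all))
qed simp

text \<open>Induction on the first list, the only one the loop tests; the other two are generalised
  since they advance to their tails. The size of \<open>x\<close> pays for the iterations because a
  tail of a pair is strictly smaller. The body is assumed correct for all stores agreeing with
  \<open>s0\<close> below \<open>n\<close>, as iterations may leave anything in the scratch
  variables.\<close>

lemma runs_search:
  assumes body: "\<And>s. \<lbrakk>\<forall>i<n. s i = s0 i; data_size (s n) \<le> M; data_size (s (n + 1)) \<le> M;
        data_size (s (n + 2)) \<le> M\<rbrakk> \<Longrightarrow>
      runs orc c s C (\<lambda>s'. (\<forall>i<n+3. s' i = s i) \<and>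
        (s' (n + 3) \<noteq> Null \<longleftrightarrow> P (s n) (s (n + 1)) (s (n + 2))))"
    and init: "\<forall>i<n. s i = s0 i" "s n = x" "s (n + 1) = y" "s (n + 2) = z" "s (n + 3) = Null"
    and size: "data_size x \<le> M" "data_size y \<le> M" "data_size z \<le> M"
  shows "runs orc (While (Var n) (search_step n c)) s (data_size x * (C + 13) + 2)
      (\<lambda>s'. (\<forall>i<n. s' i = s0 i) \<and> (s' (n + 3) \<noteq> Null \<longleftrightarrow> some_suffix P x y z))"
  using init size
proof (induction x arbitrary: s y z)
  case Null
  then show ?case by (intro runs_While_false) auto
next
  case (Atom k)
  have "runs orc c s C (\<lambda>s'. (\<forall>i<n+3. s' i = s i) \<and> (s' (n + 3) \<noteq> Null \<longleftrightarrow> P (Atom k) y z))"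
    using body[of s] Atom by simp
  note step = runs_search_step[OF this]
  show ?case
    by (rule runs_While_true[OF _ step])
      (use Atom in \<open>auto intro!: runs_While_false split: if_splits\<close>)
next
  case (Pair a x)
  have step: "runs orc c s C
      (\<lambda>s'. (\<forall>i<n+3. s' i = s i) \<and> (s' (n + 3) \<noteq> Null \<longleftrightarrow> P (data.Pair a x) y z))"
    using body[of s] Pair.prems by simp
  show ?case
  proof (rule runs_While_true[OF _ runs_search_step[OF step]])
    fix s' assume s': "(\<forall>i<n. s' i = s i) \<and>
        (if P (data.Pair a x) y z then s' n = Null \<and> s' (n + 3) \<noteq> Null
         else s' n = tail (s n) \<and> s' (n + 1) = tail (s (n + 1)) \<and> s' (n + 2) = tail (s (n + 2)) \<and>
           s' (n + 3) = Null)"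
    show "runs orc (While (Var n) (search_step n c)) s' (data_size x * (C + 13) + 2)
      (\<lambda>s'. (\<forall>i<n. s' i = s0 i) \<and> (s' (n + 3) \<noteq> Null \<longleftrightarrow> some_suffix P (data.Pair a x) y z))"
    proof (cases "P (data.Pair a x) y z")
      case True
      with s' Pair.prems show ?thesis by (intro runs_While_false) auto
    next
      case False
      have "runs orc (While (Var n) (search_step n c)) s' (data_size x * (C + 13) + 2)
        (\<lambda>s'. (\<forall>i<n. s' i = s0 i) \<and> (s' (n + 3) \<noteq> Null \<longleftrightarrow> some_suffix P x (tail y) (tail z)))"
        using s' False Pair.prems data_size_tail[of y] data_size_tail[of z]
        by (intro Pair.IH(2)) auto
      with False show ?thesis by simp
    qed
  qed (use Pair.prems in auto)
qed

text \<open>One bound \<open>M\<close> serves at every nesting depth: selectors and oracle answers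
  never exceed it. Keeping the variables below \<open>n\<close> intact lets loop cursors survive the
  bodies, which work at higher levels.\<close>

lemma runs_compile:
  assumes "well_scoped n \<phi>" "\<forall>i<n. data_size (s i) \<le> M" "1 \<le> M" "\<And>x. data_size (orc x) \<le> M"
  shows "runs orc (compile n \<phi>) s (poly (time \<phi>) M)
    (\<lambda>s'. (\<forall>i<n. s' i = s i) \<and> (s' n \<noteq> Null \<longleftrightarrow> sat orc n \<phi> s))"
  using assms(1,2)
proof (induction \<phi> arbitrary: n s)
  case (Same e e')
  then show ?case by (auto intro!: runs_Assign simp: of_truth_eq_Null)
next
  case (Neg \<phi>)
  then show ?case
    by (auto intro!: runs_Seq[OF Neg.IH] runs_Assign simp: of_truth_eq_Null leaf_eq_Null)
next
  case (Conj \<phi> \<psi>)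
  have "runs orc (Cond (Var n) (compile n \<psi>) SKIP) s1 (poly (time \<psi>) M + 3)
      (\<lambda>s'. (\<forall>i<n. s' i = s i) \<and> (s' n \<noteq> Null \<longleftrightarrow> sat orc n (Conj \<phi> \<psi>) s))"
    if s1: "(\<forall>i<n. s1 i = s i) \<and> (s1 n \<noteq> Null \<longleftrightarrow> sat orc n \<phi> s)" for s1
  proof (rule runs_Cond[where n' = "poly (time \<psi>) M + 1"])
    assume "eval (Var n) s1 \<noteq> Null"
    \<comment> \<open>The second conjunct runs in the store left by the first, which agrees with
      \<open>s\<close> below \<open>n\<close>.\<close>
    moreover have "sat orc n \<psi> s1 = sat orc n \<psi> s"
      using Conj.prems s1 by (intro sat_cong) auto
    moreover have "runs orc (compile n \<psi>) s1 (poly (time \<psi>) M)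
      (\<lambda>s'. (\<forall>i<n. s' i = s1 i) \<and> (s' n \<noteq> Null \<longleftrightarrow> sat orc n \<psi> s1))"
      using Conj.prems s1 by (intro Conj.IH) auto
    ultimately show "runs orc (compile n \<psi>) s1 (poly (time \<psi>) M + 1)
      (\<lambda>s'. (\<forall>i<n. s' i = s i) \<and> (s' n \<noteq> Null \<longleftrightarrow> sat orc n (Conj \<phi> \<psi>) s))"
      by (elim runs_mono) (use s1 in auto)
  qed (use s1 in \<open>auto intro!: runs_SKIP\<close>)
  with Conj.prems show ?case
    unfolding compile.simps by (intro runs_Seq[OF Conj.IH(1)]) auto
next
  case (Some_in e1 e2 e3 \<phi>)
  let ?P = "\<lambda>x y z. sat orc (n + 3) \<phi> (s(n := x, n + 1 := y, n + 2 := z))"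
  let ?s = "s(n := eval e1 s, n + 1 := eval e2 s, n + 2 := eval e3 s, n + 3 := Null)"
  have size: "data_size (eval e s) \<le> M" if "e \<in> {e1, e2, e3}" for e
    using Some_in.prems that assms(3) by (intro data_size_selector[of e n]) auto
  have ev: "eval e s' = eval e s" if "e \<in> {e1, e2, e3}" "\<forall>i<n. s' i = s i" for e s'
    using Some_in.prems that by (intro eval_cong[of n]) auto
  have body: "runs orc (compile (n + 3) \<phi>) s' (poly (time \<phi>) M)
      (\<lambda>s''. (\<forall>i<n+3. s'' i = s' i) \<and>
        (s'' (n + 3) \<noteq> Null \<longleftrightarrow> ?P (s' n) (s' (n + 1)) (s' (n + 2))))"
    if s': "\<forall>i<n. s' i = s i" "data_size (s' n) \<le> M" "data_size (s' (n + 1)) \<le> M"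
      "data_size (s' (n + 2)) \<le> M" for s'
  proof -
    have below: "i < n \<or> i = n \<or> i = n + 1 \<or> i = n + 2" if "i < n + 3" for i
      using that by linarith
    have "?P (s' n) (s' (n + 1)) (s' (n + 2)) = sat orc (n + 3) \<phi> s'"
      using Some_in.prems s' below by (intro sat_cong) auto
    moreover have "\<forall>i<n+3. data_size (s' i) \<le> M"
      using Some_in.prems s' below by metis
    ultimately show ?thesis
      using Some_in.IH[of "n + 3" s'] Some_in.prems by simp
  qed
  have "runs orc (While (Var n) (search_step n (compile (n + 3) \<phi>)))
      ?s (data_size (eval e1 s) * (poly (time \<phi>) M + 13) + 2)
      (\<lambda>s'. (\<forall>i<n. s' i = s i) \<and>
        (s' (n + 3) \<noteq> Null \<longleftrightarrow> some_suffix ?P (eval e1 s) (eval e2 s) (eval e3 s)))"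
    by (rule runs_search[OF body]) (use size in auto)
  \<comment> \<open>The size of the list is weakened to \<open>M\<close>, so that the bound no
    longer depends on the store.\<close>
  then have loop: "runs orc (While (Var n) (search_step n (compile (n + 3) \<phi>)))
      ?s (M * (poly (time \<phi>) M + 13) + 2)
      (\<lambda>s'. (\<forall>i<n. s' i = s i) \<and> (s' (n + 3) \<noteq> Null \<longleftrightarrow> sat orc n (Some_in e1 e2 e3 \<phi>) s))"
    by (rule runs_mono) (use size[of e1] in auto)
  let ?t = "M * (poly (time \<phi>) M + 13)"
  have search: "runs orc (Seq (While (Var n) (search_step n (compile (n + 3) \<phi>)))
        (Assign n (Var (n + 3))))
      ?s (?t + 4)
      (\<lambda>s'. (\<forall>i<n. s' i = s i) \<and> (s' n \<noteq> Null \<longleftrightarrow> sat orc n (Some_in e1 e2 e3 \<phi>) s))"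
    by (rule runs_Seq[OF loop, where ?n2.0 = 2]) (auto intro!: runs_Assign simp del: sat.simps)
  \<comment> \<open>The second and third lists are evaluated after \<open>n\<close> and
    \<open>n + 1\<close> have been overwritten, which is harmless since they read only below
    \<open>n\<close>.\<close>
  have ev2: "eval e2 (s(n := x)) = eval e2 s" for x
    by (rule ev) auto
  have ev3: "eval e3 (s(n := x, n + 1 := y)) = eval e3 s" for x y
    by (rule ev) auto
  have time_eq: "poly (time (Some_in e1 e2 e3 \<phi>)) M = eval_cost e1 + eval_cost e2 + eval_cost e3 + 9 + ?t"
    by simp
  show ?case
    unfolding compile.simps time_eq
    by (rule runs_Assign_Seq[where n' = "?t + eval_cost e2 + eval_cost e3 + 8"],
        rule runs_Assign_Seq[where n' = "?t + eval_cost e3 + 7"],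
        rule runs_Assign_Seq[where n' = "?t + 6"],
        rule runs_Assign_Seq[where n' = "?t + 4"],
        unfold ev2 ev3 eval.simps, rule search) simp_all
next
  case (Ask e \<phi>)
  let ?s = "s(n := orc (eval e s))"
  have "runs orc (compile (n + 1) \<phi>) ?s (poly (time \<phi>) M)
      (\<lambda>s'. (\<forall>i<n+1. s' i = ?s i) \<and> (s' (n + 1) \<noteq> Null \<longleftrightarrow> sat orc (n + 1) \<phi> ?s))"
    using Ask.prems assms(4) by (intro Ask.IH) (auto simp: less_Suc_eq)
  then have "runs orc (Seq (compile (n + 1) \<phi>) (Assign n (Var (n + 1)))) ?s (poly (time \<phi>) M + 2)
      (\<lambda>s'. (\<forall>i<n. s' i = s i) \<and> (s' n \<noteq> Null \<longleftrightarrow> sat orc n (Ask e \<phi>) s))"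
    by (rule runs_Seq) (auto intro!: runs_Assign)
  then show ?case
    by (auto intro!: runs_Seq[OF runs_Query[where Q = "\<lambda>s'. s' = ?s"]])
qed

text \<open>At level 1 the only free variable is the input in variable 0; the verdict is copied
  there from variable 1.\<close>

lemma decides_within_compile:
  assumes "well_scoped 1 \<phi>" "\<And>x. data_size (orc x) \<le> data_size d"
  shows "decides_within (Seq (compile 1 \<phi>) (Assign 0 (Var 1))) orc d (sat orc 1 \<phi> ((\<lambda>_. Null)(0 := d)))
    (poly (time \<phi> + [:2:]) (data_size d))"
proof -
  let ?s = "(\<lambda>_. Null)(0 := d)"
  have "runs orc (compile 1 \<phi>) ?s (poly (time \<phi>) (data_size d))
      (\<lambda>s'. (\<forall>i<1. s' i = ?s i) \<and> (s' 1 \<noteq> Null \<longleftrightarrow> sat orc 1 \<phi> ?s))"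
    using assms data_size_pos by (intro runs_compile) auto
  then have "runs orc (Seq (compile 1 \<phi>) (Assign 0 (Var 1))) ?s (poly (time \<phi> + [:2:]) (data_size d))
      (\<lambda>s'. s' 0 \<noteq> Null \<longleftrightarrow> sat orc 1 \<phi> ?s)"
    by (rule runs_Seq[where ?n2.0 = 2]) (auto intro!: runs_Assign)
  then show ?thesis by (simp add: runs_def decides_within_def)
qed

section \<open>Deciding strong certainty\<close>

lemma enc_list_simps: "enc_list [] = Null" "enc_list (x # xs) = Pair x (enc_list xs)"
  by (simp_all add: enc_list_def)

text \<open>The loop binds suffixes, but the truth of the body is assumed to depend only on their
  heads. Since all three lists are images of the same \<open>xs\<close>, the heads always belong to
  a common entry.\<close>

lemma sat_some_zip:
  assumes "eval e1 s = enc_list (map g1 xs)" "eval e2 s = enc_list (map g2 xs)"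
    "eval e3 s = enc_list (map g3 xs)"
    and "\<And>a x y z. \<lbrakk>a \<in> set xs; head x = g1 a; head y = g2 a; head z = g3 a\<rbrakk> \<Longrightarrow>
      sat orc (n + 3) \<phi> (s(n := x, n + 1 := y, n + 2 := z)) \<longleftrightarrow> Q a"
  shows "sat orc n (Some_in e1 e2 e3 \<phi>) s \<longleftrightarrow> (\<exists>a\<in>set xs. Q a)"
proof -
  have "some_suffix P (enc_list (map g1 xs)) (enc_list (map g2 xs)) (enc_list (map g3 xs)) \<longleftrightarrow>
      (\<exists>a\<in>set xs. Q a)"
    if "\<And>a x y z. \<lbrakk>a \<in> set xs; head x = g1 a; head y = g2 a; head z = g3 a\<rbrakk> \<Longrightarrow> P x y z \<longleftrightarrow> Q a" for P
    using that
  proof (induction xs)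
    case (Cons a xs)
    have "P (enc_list (map g1 (a # xs))) (enc_list (map g2 (a # xs))) (enc_list (map g3 (a # xs))) \<longleftrightarrow> Q a"
      by (rule Cons.prems) (simp_all add: enc_list_simps)
    moreover have "some_suffix P (enc_list (map g1 xs)) (enc_list (map g2 xs)) (enc_list (map g3 xs)) \<longleftrightarrow>
        (\<exists>a\<in>set xs. Q a)"
      by (rule Cons.IH, rule Cons.prems) auto
    ultimately show ?case by (simp add: enc_list_simps)
  qed (simp add: enc_list_simps)
  with assms show ?thesis by simp
qed

text \<open>The companion lists stay \<open>Null\<close> throughout, because
  \<open>tail Null\<close> is \<open>Null\<close>.\<close>

abbreviation (input) some_in :: "expr \<Rightarrow> formula \<Rightarrow> formula" where
  "some_in e \<phi> \<equiv> Some_in e NULL NULL \<phi>"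

abbreviation (input) all_in :: "expr \<Rightarrow> formula \<Rightarrow> formula" where
  "all_in e \<phi> \<equiv> Neg (some_in e (Neg \<phi>))"

abbreviation (input) implies :: "formula \<Rightarrow> formula \<Rightarrow> formula" where
  "implies \<phi> \<psi> \<equiv> Neg (Conj \<phi> (Neg \<psi>))"

lemma sat_some_in:
  assumes "eval e s = enc_list (map g xs)"
    and "\<And>a x y z. \<lbrakk>a \<in> set xs; head x = g a\<rbrakk> \<Longrightarrow>
      sat orc (n + 3) \<phi> (s(n := x, n + 1 := y, n + 2 := z)) \<longleftrightarrow> Q a"
  shows "sat orc n (some_in e \<phi>) s \<longleftrightarrow> (\<exists>a\<in>set xs. Q a)"
proof -
  have "some_suffix P (enc_list (map g xs)) y z \<longleftrightarrow> (\<exists>a\<in>set xs. Q a)"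
    if "\<And>a x y z. \<lbrakk>a \<in> set xs; head x = g a\<rbrakk> \<Longrightarrow> P x y z \<longleftrightarrow> Q a" for P y z
    using that
  proof (induction xs arbitrary: y z)
    case (Cons a xs)
    have "P (enc_list (map g (a # xs))) y z \<longleftrightarrow> Q a"
      by (rule Cons.prems) (simp_all add: enc_list_simps)
    moreover have "some_suffix P (enc_list (map g xs)) (tail y) (tail z) \<longleftrightarrow> (\<exists>a\<in>set xs. Q a)"
      by (rule Cons.IH, rule Cons.prems) auto
    ultimately show ?case by (simp add: enc_list_simps)
  qed (simp add: enc_list_simps)
  with assms show ?thesis by simp
qed

lemma sat_all_in:
  assumes "eval e s = enc_list (map g xs)"
    and "\<And>a x y z. \<lbrakk>a \<in> set xs; head x = g a\<rbrakk> \<Longrightarrow>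
      sat orc (n + 3) \<phi> (s(n := x, n + 1 := y, n + 2 := z)) \<longleftrightarrow> Q a"
  shows "sat orc n (all_in e \<phi>) s \<longleftrightarrow> (\<forall>a\<in>set xs. Q a)"
  using sat_some_in[OF assms(1), of orc n "Neg \<phi>" "\<lambda>a. \<not> Q a"] assms(2) by simp

definition listed :: "nat \<Rightarrow> expr \<Rightarrow> expr \<Rightarrow> formula" where
  "listed n e xs = some_in xs (Same (HEAD (Var n)) e)"

definition pair_listed :: "nat \<Rightarrow> expr \<Rightarrow> expr \<Rightarrow> expr \<Rightarrow> formula" where
  "pair_listed n e e' ps =
     some_in ps (Conj (Same (HEAD (HEAD (Var n))) e) (Same (TAIL (HEAD (Var n))) e'))"

lemma sat_listed:
  assumes "reads_below n e" "eval e s = Atom a" "eval xs s = enc_list (map Atom as)"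
  shows "sat orc n (listed n e xs) s \<longleftrightarrow> a \<in> set as"
proof -
  have "eval e (s(n := x, n + 1 := y, n + 2 := z)) = Atom a" for x y z
    using eval_cong[OF assms(1), of s "s(n := x, n + 1 := y, n + 2 := z)"] assms(2) by simp
  then have "sat orc n (listed n e xs) s \<longleftrightarrow> (\<exists>b\<in>set as. b = a)"
    unfolding listed_def by (intro sat_some_in[OF assms(3)]) auto
  then show ?thesis by simp
qed

lemma sat_pair_listed:
  assumes "reads_below n e" "eval e s = Atom a" "reads_below n e'" "eval e' s = Atom b"
    and "eval ps s = enc_list (map (\<lambda>(x, y). Pair (Atom x) (Atom y)) qs)"
  shows "sat orc n (pair_listed n e e' ps) s \<longleftrightarrow> (a, b) \<in> set qs"
proof -
  have "eval e (s(n := x, n + 1 := y, n + 2 := z)) = Atom a"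
    "eval e' (s(n := x, n + 1 := y, n + 2 := z)) = Atom b" for x y z
    using eval_cong[OF assms(1), of s "s(n := x, n + 1 := y, n + 2 := z)"]
      eval_cong[OF assms(3), of s "s(n := x, n + 1 := y, n + 2 := z)"] assms(2,4) by simp_all
  then have "sat orc n (pair_listed n e e' ps) s \<longleftrightarrow> (\<exists>q\<in>set qs. q = (a, b))"
    unfolding pair_listed_def by (intro sat_some_in[OF assms(5)]) (auto split: prod.splits)
  then show ?thesis by simp
qed

text \<open>
  Variable 0 holds the instance, 1 and 4 lists of tuples, 7 a list of attributes with the
  corresponding values in 8 and 9, 10 the comparison of these values, and 11, 14 and 17 lists
  of lattice elements; the heads of the lists are the current elements.
\<close>

definition split_formula :: formula where
  "split_formula = (let elems = HEAD (TAIL (HEAD (Var 7))); pairs = HEAD (TAIL (TAIL (HEAD (Var 7))));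
       below = pair_listed 20 (HEAD (Var 11)) (HEAD (Var 17)) pairs;
       above = pair_listed 20 (HEAD (Var 17)) (HEAD (Var 14)) pairs
     in all_in elems (Conj (implies below (Neg above)) (implies (Neg below) above)))"

definition witness_formula :: formula where
  "witness_formula = (let B = HEAD (HEAD (Var 7)); elems = HEAD (TAIL (HEAD (Var 7)));
       below = pair_listed 17 (HEAD (Var 11)) (Var 10) (HEAD (TAIL (TAIL (HEAD (Var 7)))))
     in some_in elems (some_in elems
       (Conj split_formula
         (Conj (implies (listed 17 B (HEAD (TAIL (TAIL (Var 0))))) below)
           (implies (Same B (HEAD (TAIL (TAIL (TAIL (Var 0)))))) (Neg below))))))"

text \<open>Tuples list their values in the order of the attributes, so a lockstep walk pairs each
  attribute with its two values. The oracle is queried before the search for \<open>(p, m)\<close>,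
  which then only consults the listed order.\<close>

definition refutation_formula :: formula where
  "refutation_formula = some_in (HEAD (TAIL (Var 0))) (some_in (HEAD (TAIL (Var 0)))
     (Neg (Some_in (HEAD (Var 0)) (HEAD (Var 1)) (HEAD (Var 4))
       (Neg (Ask (PAIR (HEAD (HEAD (Var 7))) (PAIR (HEAD (Var 8)) (HEAD (Var 9))))
         witness_formula)))))"

section \<open>The refutation formula on encoded instances\<close>

lemma well_scoped_refutation_formula: "well_scoped 1 refutation_formula"
  by (simp add: refutation_formula_def witness_formula_def split_formula_def listed_def
      pair_listed_def Let_def)

lemma enc_attribute_select:
  "head (enc_attribute B es ps) = Atom B"
  "head (tail (enc_attribute B es ps)) = enc_list (map Atom es)"
  "head (tail (tail (enc_attribute B es ps))) = enc_list (map (\<lambda>(x, y). Pair (Atom x) (Atom y)) ps)"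
  by (simp_all add: enc_attribute_def enc_list_simps)

lemma sat_split_formula:
  assumes "head (s 7) = enc_attribute B es ps" "head (s 11) = Atom p" "head (s 14) = Atom m"
  shows "sat orc 17 split_formula s \<longleftrightarrow> (\<forall>y\<in>set es. ((p, y) \<in> set ps) \<noteq> ((y, m) \<in> set ps))"
  unfolding split_formula_def Let_def
  by (rule sat_all_in[where g = Atom]) (use assms in \<open>auto simp: enc_attribute_select sat_pair_listed\<close>)

lemma sat_witness_formula:
  assumes "head (s 7) = enc_attribute B es ps" "s 10 = Atom x"
    "s 0 = enc_list [a, b, enc_list (map Atom Xs), Atom A]"
  shows "sat orc 11 witness_formula s \<longleftrightarrow>
    (\<exists>p\<in>set es. \<exists>m\<in>set es. (\<forall>y\<in>set es. ((p, y) \<in> set ps) \<noteq> ((y, m) \<in> set ps)) \<and>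
      (B \<in> set Xs \<longrightarrow> (p, x) \<in> set ps) \<and> (B = A \<longrightarrow> (p, x) \<notin> set ps))"
  unfolding witness_formula_def Let_def
proof (rule sat_some_in[where g = Atom], goal_cases)
  case 1
  show ?case using assms by (simp add: enc_attribute_select)
next
  case (2 p l y z)
  show ?case
  proof (rule sat_some_in[where g = Atom], goal_cases)
    case 1
    show ?case using assms by (simp add: enc_attribute_select)
  next
    case (2 m l' y' z')
    with \<open>head l = Atom p\<close> show ?case
      using assms by (simp add: enc_attribute_select sat_pair_listed sat_listed enc_list_simps
          sat_split_formula[where B = B and es = es and ps = ps and p = p and m = m])
  qed
qed

lemma sat_refutation_formula:
  assumes "s 0 = enc_list [enc_list (map (\<lambda>B. enc_attribute B (elems B) (pairs B)) As),
      enc_list (map (enc_tuple As) ts), enc_list (map Atom Xs), Atom A]"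
  shows "sat (comparability_oracle f) 1 refutation_formula s \<longleftrightarrow>
    (\<exists>t1\<in>set ts. \<exists>t2\<in>set ts. \<forall>B\<in>set As. \<exists>p\<in>set (elems B). \<exists>m\<in>set (elems B).
      (\<forall>y\<in>set (elems B). ((p, y) \<in> set (pairs B)) \<noteq> ((y, m) \<in> set (pairs B))) \<and>
      (B \<in> set Xs \<longrightarrow> (p, f B (t1 B) (t2 B)) \<in> set (pairs B)) \<and>
      (B = A \<longrightarrow> (p, f B (t1 B) (t2 B)) \<notin> set (pairs B)))"
  unfolding refutation_formula_def
proof (rule sat_some_in[where g = "enc_tuple As"], goal_cases)
  case 1
  show ?case using assms by (simp add: enc_list_simps)
next
  case (2 t1 l y z)
  show ?case
  proof (rule sat_some_in[where g = "enc_tuple As"], goal_cases)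
    case 1
    show ?case using assms by (simp add: enc_list_simps)
  next
    case (2 t2 l' y' z')
    \<comment> \<open>The indices remain unevaluated sums, the form in which the two outer
      quantifiers produce them.\<close>
    let ?s = "s(1 := l, 1 + 1 := y, 1 + 2 := z, 1 + 3 := l', 1 + 3 + 1 := y', 1 + 3 + 2 := z')"
    let ?W = "\<lambda>B. \<exists>p\<in>set (elems B). \<exists>m\<in>set (elems B).
      (\<forall>y\<in>set (elems B). ((p, y) \<in> set (pairs B)) \<noteq> ((y, m) \<in> set (pairs B))) \<and>
      (B \<in> set Xs \<longrightarrow> (p, f B (t1 B) (t2 B)) \<in> set (pairs B)) \<and>
      (B = A \<longrightarrow> (p, f B (t1 B) (t2 B)) \<notin> set (pairs B))"
    \<comment> \<open>The universal quantifier over attributes is a failed search for an attribute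
      without a suitable pair.\<close>
    have "sat (comparability_oracle f) (1 + 3 + 3) (Some_in (HEAD (Var 0)) (HEAD (Var 1)) (HEAD (Var 4))
       (Neg (Ask (PAIR (HEAD (HEAD (Var 7))) (PAIR (HEAD (Var 8)) (HEAD (Var 9))))
         witness_formula))) ?s \<longleftrightarrow> (\<exists>B\<in>set As. \<not> ?W B)"
    proof (rule sat_some_zip[where ?g1.0 = "\<lambda>B. enc_attribute B (elems B) (pairs B)"
          and ?g2.0 = "\<lambda>B. Atom (t1 B)" and ?g3.0 = "\<lambda>B. Atom (t2 B)"], goal_cases)
      case (4 B u v w)
      then show ?case
        using assms
        by (simp add: enc_attribute_select
            sat_witness_formula[where B = B and es = "elems B" and ps = "pairs B" and Xs = Xs and A = A])
    qed (use assms 2 \<open>head l = enc_tuple As t1\<close> in \<open>simp_all add: enc_list_simps enc_tuple_def\<close>)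
    then show ?case by (simp only: sat.simps(2)) blast
  qed
qed

lemma data_size_comparability_oracle: "data_size (comparability_oracle f x) = 1"
  by (cases "(f, x)" rule: comparability_oracle.cases) simp_all

lemma sat_refutation_formula_iff:
  assumes "schema_context U D L f" and r: "is_relation U D r" and fd: "is_fd U X A" and d: "d \<in> scfd_encodings U L r X A"
    and s: "s 0 = d"
  shows "sat (comparability_oracle f) 1 refutation_formula s \<longleftrightarrow> \<not> strongly_certain U L f r X A"
proof -
  interpret schema_context U D L f by fact
  from d obtain As elems pairs ts Xs where
    d_eq: "d = enc_list [enc_list (map (\<lambda>B. enc_attribute B (elems B) (pairs B)) As),
      enc_list (map (enc_tuple As) ts), enc_list (map Atom Xs), Atom A]"
    and sets: "set As = U" "set ts = r" "set Xs = X"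
    and elems: "\<And>B. B \<in> U \<Longrightarrow> set (elems B) = carrier (L B)"
    and pairs: "\<And>B. B \<in> U \<Longrightarrow>
      set (pairs B) = {(x, y). x \<in> carrier (L B) \<and> y \<in> carrier (L B) \<and> x \<sqsubseteq>\<^bsub>L B\<^esub> y}"
    unfolding scfd_encodings_def enumerates_def by blast
  \<comment> \<open>The listed pairs represent the order only on the carrier, so the comparison of
    the two values has to be known to lie there.\<close>
  have "(\<exists>p\<in>set (elems B). \<exists>m\<in>set (elems B).
      (\<forall>y\<in>set (elems B). ((p, y) \<in> set (pairs B)) \<noteq> ((y, m) \<in> set (pairs B))) \<and>
      (B \<in> set Xs \<longrightarrow> (p, f B (t1 B) (t2 B)) \<in> set (pairs B)) \<and>
      (B = A \<longrightarrow> (p, f B (t1 B) (t2 B)) \<notin> set (pairs B))) \<longleftrightarrow>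
    (\<exists>p m. splits (L B) p m \<and> (B \<in> X \<longrightarrow> p \<sqsubseteq>\<^bsub>L B\<^esub> f B (t1 B) (t2 B)) \<and>
      (B = A \<longrightarrow> \<not> p \<sqsubseteq>\<^bsub>L B\<^esub> f B (t1 B) (t2 B)))"
    if "t1 \<in> r" "t2 \<in> r" "B \<in> U" for t1 t2 B
    using comparison_closed[OF r that] elems[OF that(3)] pairs[OF that(3)] sets(3)
    by (auto simp: splits_def Bex_def)
  then show ?thesis
    unfolding strongly_certain_iff[OF r fd]
      sat_refutation_formula[where s = s, OF s[unfolded d_eq]] sets
    by simp
qed

theorem theorem4:
  shows "\<exists>(c :: com) (p :: nat poly).
    \<forall>(U :: nat set) (D :: nat \<Rightarrow> nat set) (L :: nat \<Rightarrow> nat gorder) (f :: nat \<Rightarrow> nat \<Rightarrow> nat \<Rightarrow> nat)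
      (r :: (nat \<Rightarrow> nat) set) (X :: nat set) (A :: nat) (d :: data).
      schema_context U D L f \<longrightarrow> is_relation U D r \<longrightarrow> is_fd U X A \<longrightarrow>
      d \<in> scfd_encodings U L r X A \<longrightarrow>
      decides_within c (comparability_oracle f) d (strongly_certain U L f r X A)
        (poly p (data_size d))"
proof (intro exI allI impI)
  fix U :: "nat set" and D L f r X A d
  assume inst: "schema_context U D L f" "is_relation U D r" "is_fd U X A"
    "d \<in> scfd_encodings U L r X A"
  \<comment> \<open>The formula is one constant, with the instance entering only through variable 0
    and the oracle, so a single program and a single polynomial serve all instances.\<close>
  let ?\<phi> = "Neg refutation_formula"
  have "decides_within (Seq (compile 1 ?\<phi>) (Assign 0 (Var 1))) (comparability_oracle f) d
      (sat (comparability_oracle f) 1 ?\<phi> ((\<lambda>_. Null)(0 := d))) (poly (time ?\<phi> + [:2:]) (data_size d))"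
    using well_scoped_refutation_formula
    by (intro decides_within_compile) (simp, simp only: data_size_comparability_oracle data_size_pos)
  then show "decides_within (Seq (compile 1 ?\<phi>) (Assign 0 (Var 1))) (comparability_oracle f) d
      (strongly_certain U L f r X A) (poly (time ?\<phi> + [:2:]) (data_size d))"
    by (simp only: sat.simps(2) sat_refutation_formula_iff[OF inst] fun_upd_same not_not)
qed

end
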